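(* Let $B$ be a (framed) chord diagram and let $a$ and $b$ be two adjacent chords of $B$. Then $${}^{\partial}\varepsilon_{B}^{\times}(z)-{}^{\partial}\varepsilon_{\widetilde{B}_{a,b}}^{\times}(z)-{}^{\partial}\varepsilon_{\widetilde{B^{\prime}}_{a,b}}^{\times}(z)+{}^{\partial}\varepsilon_{B^{\prime}_{a,b}}^{\times}(z)=0.$$
   Context: A bouquet is a ribbon graph with exactly one vertex-disc, i.e. a surface with boundary obtained from one closed disc by attaching finitely many edge-ribbons (closed discs), each along two disjoint boundary segments, all segments being disjoint. A loop is twisted if it (together with the vertex-disc) is homeomorphic to a Möbius band and untwisted if it is homeomorphic to an annulus. A chord diagram is an oriented circle with finitely many chords with pairwise distinct endpoints; it is framed, i.e. each chord is declared untwisted (framing $0$) or twisted (framing $1$). Chord diagrams are identified with bouquets: the circle is the boundary of the vertex-disc, chords are edge-ribbons, and twisted/untwisted chords are twisted/untwisted loops. For a bouquet $B$, the Euler genus is $\varepsilon(B)=1+|E(B)|-|F(B)|$, where $F(B)$ is the set of boundary components of $B$. For $A\subseteq E(B)$, the partial Petrial $B^{\times|A}$ is obtained by adding a half-twist to each edge-ribbon in $A$ (i.e. switching the framing of each chord in $A$). The partial Petrial polynomial is ${}^{\partial}\varepsilon^{\times}_{B}(z)=\sum_{A\subseteq E(B)}z^{\varepsilon(B^{\times|A})}$. Two chords $a,b$ are adjacent in $B$ if an endpoint $a_1$ of $a$ and an endpoint $b_1$ of $b$ are consecutive on the circle; fix such a pair, and let $b_2$ be the other endpoint of $b$. - $B^{\prime}_{a,b}$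 is obtained from $B$ by exchanging the two adjacent endpoints $a_1$ and $b_1$. - $\widetilde{B}_{a,b}$ is obtained from $B$ by sliding the end $a_1$ of $a$ along the edge-ribbon $b$ to the other end $b_2$ of $b$. Explicitly, if $b$ is untwisted and $a_1$ is immediately before (resp. after) $b_1$ in the cyclic order, then $a_1$ is moved to be immediately after (resp. before) $b_2$ and the framing of $a$ is unchanged; if $b$ is twisted and $a_1$ is immediately before (resp. after) $b_1$, then $a_1$ is moved to be immediately before (resp. after) $b_2$ and the framing of $a$ is switched. - $\widetilde{B^{\prime}}_{a,b}$ denotes the composition of the two operations, $(\widetilde{B}_{a,b})^{\prime}_{a,b}=\widetilde{(B^{\prime}_{a,b})}_{a,b}$ (in $\widetilde{B}_{a,b}$ the exchanged endpoints are the moved end $a_1$ and $b_2$). *)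

theory Defs
  imports "HOL-Computational_Algebra.Polynomial"
begin

text \<open>
  A framed chord diagram is given by the cyclic sequence of its chord ends, read along the
  oriented circle, and by the set of its twisted chords. The list is understood up to rotation.
  The two ends of a chord \<open>e\<close> are \<open>(e, False)\<close> and \<open>(e, True)\<close>; which end carries which
  label is immaterial.

  Read as a bouquet, the circle is the boundary of the vertex-disc, a chord is an
  edge-ribbon, and a chord end is one of the segments along which the ribbon is attached.
\<close>

type_synonym 'e chord_end = "'e \<times> bool"

record 'e chord_diagram =
  ends :: "'e chord_end list"
  twisted :: "'e set"

definition chords :: "'e chord_diagram \<Rightarrow> 'e set" where
  "chords B = fst ` set (ends B)"

definition framed_chord_diagram :: "'e chord_diagram \<Rightarrow> bool" where
  "framed_chord_diagram B \<longleftrightarrow>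
     distinct (ends B) \<and> set (ends B) = chords B \<times> UNIV \<and> twisted B \<subseteq> chords B"

definition other_end :: "'e chord_end \<Rightarrow> 'e chord_end" where
  "other_end x = (fst x, \<not> snd x)"

definition immediately_before :: "'e chord_diagram \<Rightarrow> 'e chord_end \<Rightarrow> 'e chord_end \<Rightarrow> bool" where
  "immediately_before B x y \<longleftrightarrow>
     (\<exists>i < length (ends B). ends B ! i = x \<and> ends B ! (Suc i mod length (ends B)) = y)"

definition consecutive :: "'e chord_diagram \<Rightarrow> 'e chord_end \<Rightarrow> 'e chord_end \<Rightarrow> bool" where
  "consecutive B x y \<longleftrightarrow> immediately_before B x y \<or> immediately_before B y x"

definition switch_framing :: "'e set \<Rightarrow> 'e chord_diagram \<Rightarrow> 'e chord_diagram" where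
  "switch_framing A B = B\<lparr>twisted := (twisted B - A) \<union> (A - twisted B)\<rparr>"

text \<open>
  Each attaching segment has a first and a last point with respect to the orientation of the
  circle. Cutting the boundary of the bouquet at these points leaves two kinds of arcs: the arcs
  of the circle from the last point of a segment to the first point of the next one, and the two
  free sides of each ribbon. The free sides of an untwisted ribbon (forming an annulus with the
  disc) join the first point of either segment to the last point of the other; those of a
  twisted ribbon (forming a Moebius band) join first to first and last to last.
\<close>

datatype extremity = First | Last

definition boundary_points :: "'e chord_diagram \<Rightarrow> ('e chord_end \<times> extremity) set" where
  "boundary_points B = set (ends B) \<times> UNIV"

definition circle_arcs :: "'e chord_diagram \<Rightarrow> ('e chord_end \<times> extremity) rel" where
  "circle_arcs B = {((x, Last), (y, First)) | x y. immediately_before B x y}"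

definition ribbon_sides :: "'e chord_diagram \<Rightarrow> ('e chord_end \<times> extremity) rel" where
  "ribbon_sides B =
     {((x, p), (other_end x, q)) | x p q. x \<in> set (ends B) \<and> (p = q \<longleftrightarrow> fst x \<in> twisted B)}"

definition boundary_connected :: "'e chord_diagram \<Rightarrow> ('e chord_end \<times> extremity) rel" where
  "boundary_connected B =
     (circle_arcs B \<union> (circle_arcs B)\<inverse> \<union> ribbon_sides B \<union> (ribbon_sides B)\<inverse>)\<^sup>*"

text \<open>
  A boundary component is determined by the cutting points on it, except for the bouquet without
  edges, whose only boundary component is the uncut circle.
\<close>

definition boundary_components :: "'e chord_diagram \<Rightarrow> ('e chord_end \<times> extremity) set set" where
  "boundary_components B =
     (if ends B = [] then {{}} else boundary_points B // boundary_connected B)"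

definition euler_genus :: "'e chord_diagram \<Rightarrow> int" where
  "euler_genus B = 1 + int (card (chords B)) - int (card (boundary_components B))"

text \<open>
  The conversion by \<open>nat\<close> loses nothing: identifying the two sides of every ribbon connects the
  whole boundary, so a bouquet has at most one boundary component more than it has edges.
\<close>

definition partial_petrial_poly :: "'e chord_diagram \<Rightarrow> int poly" where
  "partial_petrial_poly B =
     (\<Sum>A\<in>Pow (chords B). monom 1 (nat (euler_genus (switch_framing A B))))"

definition exchange_ends ::
    "'e chord_end \<Rightarrow> 'e chord_end \<Rightarrow> 'e chord_diagram \<Rightarrow> 'e chord_diagram" where
  "exchange_ends x y B =
     B\<lparr>ends := map (\<lambda>z. if z = x then y else if z = y then x else z) (ends B)\<rparr>"

definition move_before ::
    "'e chord_end \<Rightarrow> 'e chord_end \<Rightarrow> 'e chord_diagram \<Rightarrow> 'e chord_diagram" where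
  "move_before x y B =
     B\<lparr>ends := concat (map (\<lambda>z. if z = y then [x, y] else [z]) (removeAll x (ends B)))\<rparr>"

definition move_after ::
    "'e chord_end \<Rightarrow> 'e chord_end \<Rightarrow> 'e chord_diagram \<Rightarrow> 'e chord_diagram" where
  "move_after x y B =
     B\<lparr>ends := concat (map (\<lambda>z. if z = y then [y, x] else [z]) (removeAll x (ends B)))\<rparr>"

text \<open>
  Slide the end \<open>x\<close> along the chord of \<open>y\<close> to the other end of that chord. This is meant for
  consecutive ends \<open>x\<close> and \<open>y\<close> of two different chords; then there are at least four ends on
  the circle, so \<open>x\<close> is not both immediately before and immediately after \<open>y\<close>.
\<close>

definition slide_end ::
    "'e chord_end \<Rightarrow> 'e chord_end \<Rightarrow> 'e chord_diagram \<Rightarrow> 'e chord_diagram" where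
  "slide_end x y B =
     (if fst y \<notin> twisted B then
        (if immediately_before B x y then move_after x (other_end y) B
         else move_before x (other_end y) B)
      else switch_framing {fst x}
        (if immediately_before B x y then move_before x (other_end y) B
         else move_after x (other_end y) B))"

end

theory Submission
  imports Defs
begin

text \<open>
  Up to rotation, the diagram \<open>B\<close> and its three relatives are the four cyclic words
  \<open>a\<^sub>1 b\<^sub>1 X b\<^sub>2 Y\<close>, \<open>b\<^sub>1 a\<^sub>1 X b\<^sub>2 Y\<close>, \<open>b\<^sub>1 X a\<^sub>1 b\<^sub>2 Y\<close> and \<open>b\<^sub>1 X b\<^sub>2 a\<^sub>1 Y\<close>,
  the first two being \<open>B\<close> and \<open>B'\<close> in some order, and the last two being the slide of \<open>B\<close> and its
  exchange in some order. The partial Petrial polynomial sums over all framings of the chords, so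
  it depends on the cyclic word alone, and the claim is that the first two words have
  the same total as the last two.

  Fix a framing. Sliding an end along a ribbon is a homeomorphism of the surface, so it preserves
  the number of boundary components. The word on which the slide lands depends on whether \<open>b\<close> is
  twisted:

    \<^item> if \<open>b\<close> is untwisted, then the first word goes to the fourth and the second to the third, with
      the same framing;
    \<^item> if \<open>b\<close> is twisted, then the first word goes to the third and the second to the fourth, and
      the framing of \<open>a\<close> is switched.

  In either case the first two words are matched with the last two. The switch of the framing of \<open>a\<close>
  permutes the framings in which \<open>b\<close> is twisted, so summing over all framings
  gives the identity (\<open>framing_sum_four_term\<close>).

  The invariance of the number of boundary components is checked on the arcs themselves
  (\<open>euler_genus_slide_untwisted_before\<close>, \<open>euler_genus_slide_twisted_before\<close>): \<open>a\<^sub>1\<close> travels along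
  one free side of the ribbon of \<open>b\<close>, and apart from the two cutting points at the ends of this
  side, which subdivide a boundary curve without affecting its connections, the boundary graph is
  unchanged, up to interchanging the two points of \<open>a\<^sub>1\<close> when \<open>b\<close> is twisted.
  The second word is the mirror image of a word of the first form, and reversing the circle does
  not change the surface.
\<close>

section \<open>Connectivity of boundary arcs\<close>

lemma boundary_connected_eq:
  "boundary_connected B =
     ((circle_arcs B \<union> ribbon_sides B) \<union> (circle_arcs B \<union> ribbon_sides B)\<inverse>)\<^sup>*"
  unfolding boundary_connected_def by (rule arg_cong[where f = rtrancl]) auto

lemma boundary_connected_refl: "(x, x) \<in> boundary_connected B"
  unfolding boundary_connected_def by simp

lemma boundary_connected_sym:
  "(x, y) \<in> boundary_connected B \<Longrightarrow> (y, x) \<in> boundary_connected B"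
  unfolding boundary_connected_eq by (meson sym_Un_converse sym_rtrancl symD)

lemma boundary_connected_trans:
  "(x, y) \<in> boundary_connected B \<Longrightarrow> (y, z) \<in> boundary_connected B \<Longrightarrow>
   (x, z) \<in> boundary_connected B"
  unfolding boundary_connected_def by (rule rtrancl_trans)

lemma boundary_connected_arc:
  "immediately_before B x y \<Longrightarrow> ((x, Last), (y, First)) \<in> boundary_connected B"
  unfolding boundary_connected_def circle_arcs_def by (rule r_into_rtrancl) blast

lemma boundary_connected_side:
  "x \<in> set (ends B) \<Longrightarrow> (p = q \<longleftrightarrow> fst x \<in> twisted B) \<Longrightarrow>
   ((x, p), (other_end x, q)) \<in> boundary_connected B"
  unfolding boundary_connected_def ribbon_sides_def by (rule r_into_rtrancl) blast

text \<open>
  A map that sends each arc to a connected pair is well defined on boundary components.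
\<close>

lemma boundary_connected_image:
  assumes arc: "\<And>x y. immediately_before B x y \<Longrightarrow>
      (h (x, Last), h (y, First)) \<in> boundary_connected C"
    and side: "\<And>x p q. x \<in> set (ends B) \<Longrightarrow> (p = q \<longleftrightarrow> fst x \<in> twisted B) \<Longrightarrow>
      (h (x, p), h (other_end x, q)) \<in> boundary_connected C"
    and "(u, v) \<in> boundary_connected B"
  shows "(h u, h v) \<in> boundary_connected C"
  using assms(3) unfolding boundary_connected_eq[of B]
proof (induction rule: rtrancl_induct)
  case base
  show ?case by (rule boundary_connected_refl)
next
  case (step v w)
  have "(h s, h t) \<in> boundary_connected C" if "(s, t) \<in> circle_arcs B \<union> ribbon_sides B" for s t
    using that arc side unfolding circle_arcs_def ribbon_sides_def by blast
  then have "(h v, h w) \<in> boundary_connected C"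
    using step.hyps(2) boundary_connected_sym by blast
  with step.IH show ?case by (rule boundary_connected_trans)
qed

lemma card_image_eq_of_same_kernel:
  assumes "\<And>x y. x \<in> A \<Longrightarrow> y \<in> A \<Longrightarrow> f x = f y \<longleftrightarrow> g x = g y"
  shows "card (f ` A) = card (g ` A)"
proof -
  have retract: "g (inv_into A f (f x)) = g x" if "x \<in> A" for x
    using assms[of "inv_into A f (f x)" x] that by (simp add: inv_into_into f_inv_into_f)
  have "inj_on (\<lambda>c. g (inv_into A f c)) (f ` A)"
    using assms by (auto simp: inj_on_def retract)
  then have "card (f ` A) = card ((\<lambda>c. g (inv_into A f c)) ` f ` A)"
    by (simp add: card_image)
  also have "(\<lambda>c. g (inv_into A f c)) ` f ` A = g ` A"
    unfolding image_image by (rule image_cong) (auto simp: retract)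
  finally show ?thesis .
qed

text \<open>
  The maps \<open>h\<close> and \<open>k\<close> need not be bijections: it suffices that they are inverse to each other up to
  connectedness, for then they induce inverse bijections on boundary components. This allows a
  cutting point to be absorbed into another point of its boundary curve.
\<close>

lemma card_boundary_components_eq:
  assumes "ends B \<noteq> []" "ends C \<noteq> []"
    and arc: "\<And>x y. immediately_before B x y \<Longrightarrow>
      (h (x, Last), h (y, First)) \<in> boundary_connected C"
    and side: "\<And>x p q. x \<in> set (ends B) \<Longrightarrow> (p = q \<longleftrightarrow> fst x \<in> twisted B) \<Longrightarrow>
      (h (x, p), h (other_end x, q)) \<in> boundary_connected C"
    and arc': "\<And>x y. immediately_before C x y \<Longrightarrow>
      (k (x, Last), k (y, First)) \<in> boundary_connected B"
    and side': "\<And>x p q. x \<in> set (ends C) \<Longrightarrow> (p = q \<longleftrightarrow> fst x \<in> twisted C) \<Longrightarrow>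
      (k (x, p), k (other_end x, q)) \<in> boundary_connected B"
    and h: "\<And>x. x \<in> boundary_points B \<Longrightarrow> h x \<in> boundary_points C"
    and k: "\<And>x. x \<in> boundary_points C \<Longrightarrow> k x \<in> boundary_points B"
    and kh: "\<And>x. x \<in> boundary_points B \<Longrightarrow> (k (h x), x) \<in> boundary_connected B"
    and hk: "\<And>x. x \<in> boundary_points C \<Longrightarrow> (h (k x), x) \<in> boundary_connected C"
  shows "card (boundary_components B) = card (boundary_components C)"
proof -
  define f where "f x = boundary_connected B `` {x}" for x
  define g where "g x = boundary_connected C `` {x}" for x
  have f_eq: "f x = f y \<longleftrightarrow> (x, y) \<in> boundary_connected B" for x y
    unfolding f_def
    using boundary_connected_refl boundary_connected_sym boundary_connected_trans by blast
  have g_eq: "g x = g y \<longleftrightarrow> (x, y) \<in> boundary_connected C" for x y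
    unfolding g_def
    using boundary_connected_refl boundary_connected_sym boundary_connected_trans by blast
  have himg: "(h x, h y) \<in> boundary_connected C" if "(x, y) \<in> boundary_connected B" for x y
    using boundary_connected_image[of B h C, OF arc side that] .
  have kimg: "(k x, k y) \<in> boundary_connected B" if "(x, y) \<in> boundary_connected C" for x y
    using boundary_connected_image[of C k B, OF arc' side' that] .
  have same_kernel: "f x = f y \<longleftrightarrow> g (h x) = g (h y)"
    if "x \<in> boundary_points B" "y \<in> boundary_points B" for x y
  proof
    assume "f x = f y"
    then show "g (h x) = g (h y)" using himg by (simp add: f_eq g_eq)
  next
    assume "g (h x) = g (h y)"
    then have "f (k (h x)) = f (k (h y))" using kimg by (simp add: f_eq g_eq)
    moreover have "f (k (h x)) = f x" "f (k (h y)) = f y" using kh that by (simp_all add: f_eq)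
    ultimately show "f x = f y" by simp
  qed
  have "card (f ` boundary_points B) = card ((g \<circ> h) ` boundary_points B)"
    using same_kernel by (intro card_image_eq_of_same_kernel) simp
  moreover have "(g \<circ> h) ` boundary_points B = g ` boundary_points C"
  proof -
    have "g y \<in> (g \<circ> h) ` boundary_points B" if "y \<in> boundary_points C" for y
      using k[OF that] hk[OF that] g_eq[of "h (k y)" y] by (metis comp_apply imageI)
    then show ?thesis using h by auto
  qed
  moreover have "boundary_components B = f ` boundary_points B"
    "boundary_components C = g ` boundary_points C"
    using assms(1,2) unfolding boundary_components_def quotient_def f_def g_def by auto
  ultimately show ?thesis by simp
qed

section \<open>Cyclic words\<close>

text \<open>
  The circular successor relation of the word \<open>x # xs\<close> is \<open>steps (x # xs @ [x])\<close>; a linear word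
  has the advantage that it can be cut at any letter.
\<close>

definition steps :: "'a list \<Rightarrow> 'a rel" where
  "steps l = set (zip l (tl l))"

lemma steps_Cons: "steps (x # y # l) = insert (x, y) (steps (y # l))"
  by (simp add: steps_def)

lemma steps_Cons_append: "steps (x # xs @ y # ys) = steps (x # xs @ [y]) \<union> steps (y # ys)"
  by (induction xs arbitrary: x) (auto simp: steps_def)

lemma steps_snoc: "steps (x # xs @ [y]) = insert (last (x # xs), y) (steps (x # xs))"
  by (induction xs arbitrary: x) (auto simp: steps_def)

lemma steps_rev: "steps (rev l) = (steps l)\<inverse>"
proof (induction l rule: induct_list012)
  case (3 x y zs)
  have "steps (rev (x # y # zs)) = steps (rev zs @ [y, x])" by simp
  also have "\<dots> = insert (y, x) (steps (rev (y # zs)))"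
  proof (cases "rev zs")
    case Nil then show ?thesis by (simp add: steps_def)
  next
    case (Cons w ws)
    then show ?thesis using steps_Cons_append[of w ws y "[x]"] by (auto simp: steps_def)
  qed
  finally show ?case using 3 by (auto simp: steps_Cons)
qed (auto simp: steps_def)

lemma steps_mem:
  assumes "(u, v) \<in> steps l"
  shows "u \<in> set (butlast l)" and "v \<in> set (tl l)"
proof -
  obtain i where "i < length (tl l)" "u = l ! i" "v = tl l ! i"
    using assms by (auto simp: steps_def in_set_zip)
  then show "u \<in> set (butlast l)" "v \<in> set (tl l)"
    by (auto simp: in_set_conv_nth intro!: exI[of _ i] simp: nth_butlast)
qed

lemma immediately_before_iff_steps:
  assumes "ends B = x # xs"
  shows "immediately_before B u v \<longleftrightarrow> (u, v) \<in> steps (x # xs @ [x])"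
proof -
  have "(x # xs @ [x]) ! i = ends B ! i \<and> (xs @ [x]) ! i = ends B ! (Suc i mod length (ends B))"
    if "i < Suc (length xs)" for i
    using that assms by (cases "i = length xs") (auto simp: nth_append nth_Cons split: nat.splits)
  moreover have "(u, v) \<in> steps (x # xs @ [x]) \<longleftrightarrow>
      (\<exists>i < Suc (length xs). (x # xs @ [x]) ! i = u \<and> (xs @ [x]) ! i = v)"
    by (auto simp: steps_def in_set_zip)
  ultimately show ?thesis
    using assms unfolding immediately_before_def by simp (metis)
qed

lemma immediately_before_rotate:
  assumes "ends B = xs @ ys" and "ends C = ys @ xs"
  shows "immediately_before B = immediately_before C"
proof (cases "xs = [] \<or> ys = []")
  case True
  then show ?thesis using assms by (auto simp: immediately_before_def fun_eq_iff)
next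
  case False
  then obtain x xs' y ys' where xy: "xs = x # xs'" "ys = y # ys'"
    by (meson neq_Nil_conv)
  have "ends B = x # (xs' @ y # ys')" "ends C = y # (ys' @ x # xs')"
    using assms xy by simp_all
  moreover have "steps (x # (xs' @ y # ys') @ [x]) = steps (y # (ys' @ x # xs') @ [y])"
    using steps_Cons_append[of x xs' y "ys' @ [x]"] steps_Cons_append[of y ys' x "xs' @ [y]"]
    by (simp add: Un_commute)
  ultimately show ?thesis
    by (intro ext) (simp add: immediately_before_iff_steps)
qed

lemma euler_genus_rotate:
  "euler_genus \<lparr>ends = xs @ ys, twisted = T\<rparr> = euler_genus \<lparr>ends = ys @ xs, twisted = T\<rparr>"
proof -
  let ?B = "\<lparr>ends = xs @ ys, twisted = T\<rparr>" and ?C = "\<lparr>ends = ys @ xs, twisted = T\<rparr>"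
  have "immediately_before ?B = immediately_before ?C"
    by (rule immediately_before_rotate) auto
  then have "circle_arcs ?B = circle_arcs ?C" "ribbon_sides ?B = ribbon_sides ?C"
    "boundary_points ?B = boundary_points ?C"
    by (auto simp: circle_arcs_def ribbon_sides_def boundary_points_def)
  then have "boundary_components ?B = boundary_components ?C"
    by (simp add: boundary_components_def boundary_connected_def)
  then show ?thesis by (simp add: euler_genus_def chords_def Un_commute)
qed

fun flip :: "extremity \<Rightarrow> extremity" where
  "flip First = Last" | "flip Last = First"

lemma flip_flip: "flip (flip p) = p" by (cases p) auto
lemma flip_eq: "flip p = flip q \<longleftrightarrow> p = q" by (cases p; cases q) auto

lemma immediately_before_rev:
  assumes "ends B = l" and "ends C = rev l"
  shows "immediately_before C x y \<longleftrightarrow> immediately_before B y x"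
proof (cases l)
  case Nil
  then show ?thesis using assms by (simp add: immediately_before_def)
next
  case (Cons z zs)
  let ?D = "\<lparr>ends = z # rev zs, twisted = {}\<rparr>"
  have "immediately_before C = immediately_before ?D"
    by (rule immediately_before_rotate) (use assms Cons in auto)
  moreover have "immediately_before ?D x y \<longleftrightarrow> (x, y) \<in> steps (rev (z # zs @ [z]))"
    by (subst immediately_before_iff_steps) auto
  ultimately show ?thesis
    using assms Cons unfolding steps_rev by (simp add: immediately_before_iff_steps)
qed

text \<open>
  Reversing the orientation of the circle interchanges the first and the last point of every
  attaching segment, which turns each arc around and respects the type of every ribbon.
\<close>

lemma euler_genus_rev:
  "euler_genus \<lparr>ends = rev l, twisted = T\<rparr> = euler_genus \<lparr>ends = l, twisted = T\<rparr>"
proof (cases "l = []")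
  case False
  let ?B = "\<lparr>ends = rev l, twisted = T\<rparr>" and ?C = "\<lparr>ends = l, twisted = T\<rparr>"
  have rev: "immediately_before ?B x y \<longleftrightarrow> immediately_before ?C y x" for x y
    by (rule immediately_before_rev) auto
  have "card (boundary_components ?B) = card (boundary_components ?C)"
    by (rule card_boundary_components_eq[where h = "map_prod id flip" and k = "map_prod id flip"])
       (use False in \<open>auto simp: rev boundary_points_def flip_flip flip_eq
           intro: boundary_connected_refl boundary_connected_side
             boundary_connected_sym[OF boundary_connected_arc]\<close>)
  then show ?thesis by (simp add: euler_genus_def chords_def)
qed simp

section \<open>Sliding an end along a ribbon\<close>

lemma other_end_other_end: "other_end (other_end x) = x"
  by (simp add: other_end_def)

text \<open>
  Write \<open>p\<close> for the last and \<open>s\<close> for the first letter of \<open>Y\<close>. Near the free side of the ribbon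
  of \<open>b\<close> from the first point of \<open>b\<^sub>1\<close> to the last point of \<open>b\<^sub>2\<close>, the boundary before the slide
  consists of the paths

    \<^item> \<open>(p, Last) - (a\<^sub>1, First)\<close>
    \<^item> \<open>(a\<^sub>1, Last) - (b\<^sub>1, First) - (b\<^sub>2, Last) - (s, First)\<close>

  and after the slide of

    \<^item> \<open>(p, Last) - (b\<^sub>1, First) - (b\<^sub>2, Last) - (a\<^sub>1, First)\<close>
    \<^item> \<open>(a\<^sub>1, Last) - (s, First)\<close>

  Dropping the two points of the free side makes the pictures agree.
\<close>

lemma euler_genus_slide_untwisted_before:
  fixes a\<^sub>1 b\<^sub>1 b\<^sub>2 :: "'e chord_end"
  assumes dist: "distinct (a\<^sub>1 # b\<^sub>1 # X @ b\<^sub>2 # Y)" and b\<^sub>2: "b\<^sub>2 = other_end b\<^sub>1"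
    and T: "fst b\<^sub>1 \<notin> T"
  shows "euler_genus \<lparr>ends = a\<^sub>1 # b\<^sub>1 # X @ b\<^sub>2 # Y, twisted = T\<rparr>
       = euler_genus \<lparr>ends = b\<^sub>1 # X @ b\<^sub>2 # a\<^sub>1 # Y, twisted = T\<rparr>"
proof (cases "Y = []")
  \<comment> \<open>Without letters between \<open>b\<^sub>2\<close> and \<open>a\<^sub>1\<close> the slide only rotates the word.\<close>
  case True
  then show ?thesis using euler_genus_rotate[of "[a\<^sub>1]" "b\<^sub>1 # X @ [b\<^sub>2]"] by simp
next
  case False
  then have last_Y: "last Y \<in> set Y" and hd_Y: "hd Y \<in> set Y" by auto
  let ?B = "\<lparr>ends = a\<^sub>1 # b\<^sub>1 # X @ b\<^sub>2 # Y, twisted = T\<rparr>"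
  let ?C = "\<lparr>ends = b\<^sub>1 # X @ b\<^sub>2 # a\<^sub>1 # Y, twisted = T\<rparr>"
  have steps_Y: "steps (z # Y @ [w]) = insert (z, hd Y) (insert (last Y, w) (steps Y))" for z w
    using False by (cases Y) (auto simp: steps_Cons steps_snoc)
  have B: "immediately_before ?B x y \<longleftrightarrow>
      (x, y) \<in> {(a\<^sub>1, b\<^sub>1), (b\<^sub>2, hd Y), (last Y, a\<^sub>1)} \<union> steps (b\<^sub>1 # X @ [b\<^sub>2]) \<union> steps Y" for x y
    using steps_Cons_append[of b\<^sub>1 X b\<^sub>2 "Y @ [a\<^sub>1]"] steps_Y[of b\<^sub>2 a\<^sub>1]
    by (subst immediately_before_iff_steps) (auto simp: steps_Cons)
  have C: "immediately_before ?C x y \<longleftrightarrow>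
      (x, y) \<in> {(b\<^sub>2, a\<^sub>1), (a\<^sub>1, hd Y), (last Y, b\<^sub>1)} \<union> steps (b\<^sub>1 # X @ [b\<^sub>2]) \<union> steps Y" for x y
    using steps_Cons_append[of b\<^sub>1 X b\<^sub>2 "a\<^sub>1 # Y @ [b\<^sub>1]"] steps_Y[of a\<^sub>1 b\<^sub>1]
    by (subst immediately_before_iff_steps) (auto simp: steps_Cons)
  have X_steps: "x \<noteq> b\<^sub>2 \<and> y \<noteq> b\<^sub>1" if "(x, y) \<in> steps (b\<^sub>1 # X @ [b\<^sub>2])" for x y
    using steps_mem[OF that] dist by auto
  have Y_steps: "x \<in> set Y \<and> y \<in> set Y" if "(x, y) \<in> steps Y" for x y
    using steps_mem[OF that] by (auto dest: in_set_butlastD list.set_sel(2)[rotated])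
  \<comment> \<open>Absorb the free side into \<open>v\<close>: the last point of \<open>a\<^sub>1\<close> lies on the boundary curve of the
    free side before the slide, the first point of \<open>a\<^sub>1\<close> after it.\<close>
  define collapse where "collapse v x =
    (if x = (b\<^sub>1, First) \<or> x = (b\<^sub>2, Last) then v else x)" for v x :: "'e chord_end \<times> extremity"
  have fst_b: "fst b\<^sub>2 = fst b\<^sub>1" "other_end b\<^sub>2 = b\<^sub>1" "b\<^sub>1 \<noteq> b\<^sub>2"
    using b\<^sub>2 dist by (auto simp: other_end_def)
  have other: "other_end x = b\<^sub>1 \<longleftrightarrow> x = b\<^sub>2" "other_end x = b\<^sub>2 \<longleftrightarrow> x = b\<^sub>1" for x
    using b\<^sub>2 by (auto simp: other_end_def prod_eq_iff)
  have side: "(collapse v (x, p), collapse v (other_end x, q)) \<in> boundary_connected D"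
    if "set (ends D) = set (ends ?B)" "twisted D = T" "x \<in> set (ends D)"
      "p = q \<longleftrightarrow> fst x \<in> T" for D v x p q
    using that boundary_connected_side[of x D p q] T fst_b
    by (cases p; cases q; cases "x = b\<^sub>1"; cases "x = b\<^sub>2")
       (auto simp: collapse_def other fst_b fst_b(3)[symmetric] boundary_connected_refl)
  have b_arc: "((b\<^sub>1, First), (b\<^sub>2, Last)) \<in> boundary_connected D"
    if "set (ends D) = set (ends ?B)" "twisted D = T" for D
    using boundary_connected_side[of b\<^sub>1 D First Last] that T b\<^sub>2 by simp
  have B_arcs: "((a\<^sub>1, Last), (b\<^sub>1, First)) \<in> boundary_connected ?B"
    "((b\<^sub>2, Last), (hd Y, First)) \<in> boundary_connected ?B"
    "((last Y, Last), (a\<^sub>1, First)) \<in> boundary_connected ?B"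
    by (rule boundary_connected_arc, simp add: B)+
  have C_arcs: "((b\<^sub>2, Last), (a\<^sub>1, First)) \<in> boundary_connected ?C"
    "((a\<^sub>1, Last), (hd Y, First)) \<in> boundary_connected ?C"
    "((last Y, Last), (b\<^sub>1, First)) \<in> boundary_connected ?C"
    by (rule boundary_connected_arc, simp add: C)+
  have a_b_B: "((a\<^sub>1, Last), (b\<^sub>2, Last)) \<in> boundary_connected ?B"
    using B_arcs(1) b_arc[of ?B] by (auto intro: boundary_connected_trans)
  have a_hd_B: "((a\<^sub>1, Last), (hd Y, First)) \<in> boundary_connected ?B"
    using a_b_B B_arcs(2) by (rule boundary_connected_trans)
  have a_b_C: "((b\<^sub>1, First), (a\<^sub>1, First)) \<in> boundary_connected ?C"
    by (rule boundary_connected_trans[OF b_arc C_arcs(1)]) auto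
  have last_a_C: "((last Y, Last), (a\<^sub>1, First)) \<in> boundary_connected ?C"
    using C_arcs(3) a_b_C by (rule boundary_connected_trans)
  have "card (boundary_components ?B) = card (boundary_components ?C)"
  proof (rule card_boundary_components_eq[where h = "collapse (a\<^sub>1, Last)" and k = "collapse (a\<^sub>1, First)"])
    fix x y assume "immediately_before ?B x y"
    then consider "x = a\<^sub>1" "y = b\<^sub>1" | "x = b\<^sub>2" "y = hd Y" | "x = last Y" "y = a\<^sub>1"
      | "x \<noteq> b\<^sub>2" "y \<noteq> b\<^sub>1" "immediately_before ?C x y"
      unfolding B C using X_steps[of x y] Y_steps[of x y] dist by auto
    then show "(collapse (a\<^sub>1, Last) (x, Last), collapse (a\<^sub>1, Last) (y, First)) \<in> boundary_connected ?C"
      using hd_Y last_Y dist fst_b C_arcs last_a_C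
      by cases (auto simp: collapse_def boundary_connected_refl boundary_connected_arc)
  next
    fix x y assume "immediately_before ?C x y"
    then consider "x = b\<^sub>2" "y = a\<^sub>1" | "x = a\<^sub>1" "y = hd Y" | "x = last Y" "y = b\<^sub>1"
      | "x \<noteq> b\<^sub>2" "y \<noteq> b\<^sub>1" "immediately_before ?B x y"
      unfolding B C using X_steps[of x y] Y_steps[of x y] dist by auto
    then show "(collapse (a\<^sub>1, First) (x, Last), collapse (a\<^sub>1, First) (y, First)) \<in> boundary_connected ?B"
      using hd_Y last_Y dist fst_b B_arcs a_hd_B
      by cases (auto simp: collapse_def boundary_connected_refl boundary_connected_arc)
  next
    fix x assume "x \<in> boundary_points ?B"
    show "(collapse (a\<^sub>1, First) (collapse (a\<^sub>1, Last) x), x) \<in> boundary_connected ?B"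
      using B_arcs(1) a_b_B dist by (auto simp: collapse_def boundary_connected_refl)
  next
    fix x assume "x \<in> boundary_points ?C"
    show "(collapse (a\<^sub>1, Last) (collapse (a\<^sub>1, First) x), x) \<in> boundary_connected ?C"
      using a_b_C[THEN boundary_connected_sym] C_arcs(1)[THEN boundary_connected_sym] dist
      by (auto simp: collapse_def boundary_connected_refl)
  next
    fix x and p q :: extremity assume "x \<in> set (ends ?B)" "p = q \<longleftrightarrow> fst x \<in> twisted ?B"
    then show "(collapse (a\<^sub>1, Last) (x, p), collapse (a\<^sub>1, Last) (other_end x, q))
        \<in> boundary_connected ?C"
      by (intro side) auto
  next
    fix x and p q :: extremity assume "x \<in> set (ends ?C)" "p = q \<longleftrightarrow> fst x \<in> twisted ?C"
    then show "(collapse (a\<^sub>1, First) (x, p), collapse (a\<^sub>1, First) (other_end x, q))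
        \<in> boundary_connected ?B"
      by (intro side) auto
  qed (auto simp: collapse_def boundary_points_def)
  moreover have "chords ?B = chords ?C" by (auto simp: chords_def)
  ultimately show ?thesis by (simp add: euler_genus_def)
qed

text \<open>
  The free side of the ribbon of \<open>b\<close> now joins the first points of \<open>b\<^sub>1\<close> and \<open>b\<^sub>2\<close>, and \<open>a\<^sub>1\<close> arrives
  at \<open>b\<^sub>2\<close> with its orientation reversed. With \<open>r\<close> the letter before \<open>b\<^sub>2\<close> in \<open>b\<^sub>1 X b\<^sub>2\<close> and \<open>s\<close>
  the letter before \<open>a\<^sub>1\<close> in \<open>b\<^sub>2 Y a\<^sub>1\<close>, the paths

    \<^item> \<open>(s, Last) - (a\<^sub>1, First)\<close>
    \<^item> \<open>(a\<^sub>1, Last) - (b\<^sub>1, First) - (b\<^sub>2, First) - (r, Last)\<close>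

  become

    \<^item> \<open>(s, Last) - (b\<^sub>1, First) - (b\<^sub>2, First) - (a\<^sub>1, Last)\<close>
    \<^item> \<open>(a\<^sub>1, First) - (r, Last)\<close>

  Besides dropping the two points of the free side, one has to interchange the two points of
  \<open>a\<^sub>1\<close>; this interchange is what switches the framing of \<open>a\<close>.
\<close>

lemma euler_genus_slide_twisted_before:
  fixes a\<^sub>1 b\<^sub>1 b\<^sub>2 :: "'e chord_end"
  assumes dist: "distinct (a\<^sub>1 # b\<^sub>1 # X @ b\<^sub>2 # Y)" and b\<^sub>2: "b\<^sub>2 = other_end b\<^sub>1"
    and ab: "fst a\<^sub>1 \<noteq> fst b\<^sub>1" and T: "fst b\<^sub>1 \<in> T"
    and T': "\<And>e. e \<in> T' \<longleftrightarrow> (e \<in> T \<longleftrightarrow> e \<noteq> fst a\<^sub>1)"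
  shows "euler_genus \<lparr>ends = a\<^sub>1 # b\<^sub>1 # X @ b\<^sub>2 # Y, twisted = T\<rparr>
       = euler_genus \<lparr>ends = b\<^sub>1 # X @ a\<^sub>1 # b\<^sub>2 # Y, twisted = T'\<rparr>"
proof -
  let ?B = "\<lparr>ends = a\<^sub>1 # b\<^sub>1 # X @ b\<^sub>2 # Y, twisted = T\<rparr>"
  let ?C = "\<lparr>ends = b\<^sub>1 # X @ a\<^sub>1 # b\<^sub>2 # Y, twisted = T'\<rparr>"
  define r where "r = last (b\<^sub>1 # X)"
  define s where "s = last (b\<^sub>2 # Y)"
  have r: "r \<in> insert b\<^sub>1 (set X)" and s: "s \<in> insert b\<^sub>2 (set Y)"
    using last_in_set[of "b\<^sub>1 # X"] last_in_set[of "b\<^sub>2 # Y"] by (simp_all add: r_def s_def)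
  have B: "immediately_before ?B x y \<longleftrightarrow>
      (x, y) \<in> {(a\<^sub>1, b\<^sub>1), (r, b\<^sub>2), (s, a\<^sub>1)} \<union> steps (b\<^sub>1 # X) \<union> steps (b\<^sub>2 # Y)" for x y
    using steps_Cons_append[of b\<^sub>1 X b\<^sub>2 "Y @ [a\<^sub>1]"] steps_snoc[of b\<^sub>1 X b\<^sub>2] steps_snoc[of b\<^sub>2 Y a\<^sub>1]
    by (subst immediately_before_iff_steps) (auto simp: steps_Cons r_def s_def)
  have C: "immediately_before ?C x y \<longleftrightarrow>
      (x, y) \<in> {(a\<^sub>1, b\<^sub>2), (r, a\<^sub>1), (s, b\<^sub>1)} \<union> steps (b\<^sub>1 # X) \<union> steps (b\<^sub>2 # Y)" for x y
    using steps_Cons_append[of b\<^sub>1 X a\<^sub>1 "b\<^sub>2 # Y @ [b\<^sub>1]"] steps_snoc[of b\<^sub>1 X a\<^sub>1] steps_snoc[of b\<^sub>2 Y b\<^sub>1]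
    by (subst immediately_before_iff_steps) (auto simp: steps_Cons r_def s_def)
  have X_steps: "x \<noteq> a\<^sub>1 \<and> y \<noteq> a\<^sub>1 \<and> y \<noteq> b\<^sub>1 \<and> y \<noteq> b\<^sub>2" if "(x, y) \<in> steps (b\<^sub>1 # X)" for x y
    using steps_mem[OF that] dist by (auto dest: in_set_butlastD split: if_splits)
  have Y_steps: "x \<noteq> a\<^sub>1 \<and> y \<noteq> a\<^sub>1 \<and> y \<noteq> b\<^sub>1 \<and> y \<noteq> b\<^sub>2" if "(x, y) \<in> steps (b\<^sub>2 # Y)" for x y
    using steps_mem[OF that] dist by (auto dest: in_set_butlastD split: if_splits)
  \<comment> \<open>On either side, the free side lies on the boundary curve of the last point of \<open>a\<^sub>1\<close>, which
    corresponds to the first point on the other side; hence one map serves both directions.\<close>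
  define h where "h x =
    (if x = (b\<^sub>1, First) \<or> x = (b\<^sub>2, First) then (a\<^sub>1, First)
     else if fst x = a\<^sub>1 then (a\<^sub>1, flip (snd x)) else x)" for x :: "'e chord_end \<times> extremity"
  have fst_b: "fst b\<^sub>2 = fst b\<^sub>1" "other_end b\<^sub>2 = b\<^sub>1" "b\<^sub>1 \<noteq> b\<^sub>2"
    using b\<^sub>2 dist by (auto simp: other_end_def)
  have neq: "a\<^sub>1 \<noteq> b\<^sub>1" "a\<^sub>1 \<noteq> b\<^sub>2" using dist by auto
  have other: "other_end x = b\<^sub>1 \<longleftrightarrow> x = b\<^sub>2" "other_end x = b\<^sub>2 \<longleftrightarrow> x = b\<^sub>1"
    "other_end x = a\<^sub>1 \<longleftrightarrow> x = other_end a\<^sub>1" for x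
    using b\<^sub>2 by (auto simp: other_end_def prod_eq_iff)
  have side: "(h (x, p), h (other_end x, q)) \<in> boundary_connected D"
    if "x \<in> set (ends D)" "fst b\<^sub>1 \<in> twisted D"
      and S: "p = q \<longleftrightarrow> (fst x \<in> twisted D \<longleftrightarrow> fst x \<noteq> fst a\<^sub>1)"
    for D :: "'e chord_diagram" and x :: "'e chord_end" and p q
  proof (cases "fst x = fst a\<^sub>1")
    case True
    then have a: "x = a\<^sub>1 \<or> x = other_end a\<^sub>1" by (auto simp: other_end_def prod_eq_iff)
    have "x \<noteq> b\<^sub>1" "x \<noteq> b\<^sub>2" using True ab fst_b by auto
    moreover have "other_end a\<^sub>1 \<noteq> a\<^sub>1" "other_end (other_end a\<^sub>1) = a\<^sub>1"
      by (auto simp: other_end_def prod_eq_iff)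
    ultimately show ?thesis
      using a boundary_connected_side[of x D "flip p" q] boundary_connected_side[of x D p "flip q"]
        that True
      by (cases p; cases q) (auto simp: h_def other other_end_other_end)
  next
    case False
    then have "x \<noteq> a\<^sub>1" "other_end x \<noteq> a\<^sub>1" by (auto simp: other_end_def)
    then show ?thesis
      using that boundary_connected_side[of x D p q] False fst_b
      by (cases p; cases q; cases "x = b\<^sub>1"; cases "x = b\<^sub>2")
         (auto simp: h_def other fst_b fst_b(3)[symmetric] boundary_connected_refl)
  qed
  have TT': "fst b\<^sub>1 \<in> T'" using T' T ab by auto
  have b_B: "((b\<^sub>1, First), (b\<^sub>2, First)) \<in> boundary_connected ?B"
    using boundary_connected_side[of b\<^sub>1 ?B First First] T b\<^sub>2 by simp
  have b_C: "((b\<^sub>1, First), (b\<^sub>2, First)) \<in> boundary_connected ?C"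
    using boundary_connected_side[of b\<^sub>1 ?C First First] TT' b\<^sub>2 by simp
  have B_arcs: "((a\<^sub>1, Last), (b\<^sub>1, First)) \<in> boundary_connected ?B"
    "((r, Last), (b\<^sub>2, First)) \<in> boundary_connected ?B"
    "((s, Last), (a\<^sub>1, First)) \<in> boundary_connected ?B"
    by (rule boundary_connected_arc, simp add: B)+
  have C_arcs: "((a\<^sub>1, Last), (b\<^sub>2, First)) \<in> boundary_connected ?C"
    "((r, Last), (a\<^sub>1, First)) \<in> boundary_connected ?C"
    "((s, Last), (b\<^sub>1, First)) \<in> boundary_connected ?C"
    by (rule boundary_connected_arc, simp add: C)+
  have a_b_B: "((a\<^sub>1, Last), (b\<^sub>2, First)) \<in> boundary_connected ?B"
    using B_arcs(1) b_B by (rule boundary_connected_trans)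
  have a_b_C: "((a\<^sub>1, Last), (b\<^sub>1, First)) \<in> boundary_connected ?C"
    using C_arcs(1) b_C[THEN boundary_connected_sym] by (rule boundary_connected_trans)
  have r_a_B: "((r, Last), (a\<^sub>1, Last)) \<in> boundary_connected ?B"
    using B_arcs(2) a_b_B[THEN boundary_connected_sym] by (rule boundary_connected_trans)
  have s_a_C: "((s, Last), (a\<^sub>1, Last)) \<in> boundary_connected ?C"
    using C_arcs(3) a_b_C[THEN boundary_connected_sym] by (rule boundary_connected_trans)
  have rs: "r \<noteq> a\<^sub>1" "s \<noteq> a\<^sub>1" using r s dist by auto
  have "card (boundary_components ?B) = card (boundary_components ?C)"
  proof (rule card_boundary_components_eq[where h = h and k = h])
    fix x y assume "immediately_before ?B x y"
    then consider "x = a\<^sub>1" "y = b\<^sub>1" | "x = r" "y = b\<^sub>2" | "x = s" "y = a\<^sub>1"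
      | "x \<noteq> a\<^sub>1" "y \<noteq> a\<^sub>1" "y \<noteq> b\<^sub>1" "y \<noteq> b\<^sub>2" "immediately_before ?C x y"
      unfolding B C using X_steps[of x y] Y_steps[of x y] by auto
    then show "(h (x, Last), h (y, First)) \<in> boundary_connected ?C"
      using rs neq C_arcs s_a_C
      by cases (auto simp: h_def boundary_connected_refl boundary_connected_arc)
  next
    fix x y assume "immediately_before ?C x y"
    then consider "x = a\<^sub>1" "y = b\<^sub>2" | "x = r" "y = a\<^sub>1" | "x = s" "y = b\<^sub>1"
      | "x \<noteq> a\<^sub>1" "y \<noteq> a\<^sub>1" "y \<noteq> b\<^sub>1" "y \<noteq> b\<^sub>2" "immediately_before ?B x y"
      unfolding B C using X_steps[of x y] Y_steps[of x y] by auto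
    then show "(h (x, Last), h (y, First)) \<in> boundary_connected ?B"
      using rs neq B_arcs r_a_B
      by cases (auto simp: h_def boundary_connected_refl boundary_connected_arc)
  next
    fix x assume "x \<in> boundary_points ?B"
    show "(h (h x), x) \<in> boundary_connected ?B"
      using B_arcs(1) a_b_B neq by (auto simp: h_def boundary_connected_refl flip_flip)
  next
    fix x assume "x \<in> boundary_points ?C"
    show "(h (h x), x) \<in> boundary_connected ?C"
      using a_b_C C_arcs(1) neq by (auto simp: h_def boundary_connected_refl flip_flip)
  next
    fix x and p q :: extremity assume "x \<in> set (ends ?B)" "p = q \<longleftrightarrow> fst x \<in> twisted ?B"
    then show "(h (x, p), h (other_end x, q)) \<in> boundary_connected ?C"
      using T' TT' by (intro side) auto
  next
    fix x and p q :: extremity assume "x \<in> set (ends ?C)" "p = q \<longleftrightarrow> fst x \<in> twisted ?C"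
    then show "(h (x, p), h (other_end x, q)) \<in> boundary_connected ?B"
      using T' T by (intro side) auto
  qed (auto simp: h_def boundary_points_def)
  moreover have "chords ?B = chords ?C" by (auto simp: chords_def)
  ultimately show ?thesis by (simp add: euler_genus_def)
qed

text \<open>
  If \<open>a\<^sub>1\<close> comes after \<open>b\<^sub>1\<close>, it comes before \<open>b\<^sub>1\<close> in the reversed word, with the reversals of
  \<open>Y\<close> and \<open>X\<close> in the places of \<open>X\<close> and \<open>Y\<close>.
\<close>

lemma euler_genus_slide_untwisted_after:
  assumes dist: "distinct (a\<^sub>1 # b\<^sub>1 # X @ b\<^sub>2 # Y)" and b\<^sub>2: "b\<^sub>2 = other_end b\<^sub>1"
    and T: "fst b\<^sub>1 \<notin> T"
  shows "euler_genus \<lparr>ends = b\<^sub>1 # a\<^sub>1 # X @ b\<^sub>2 # Y, twisted = T\<rparr>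
       = euler_genus \<lparr>ends = b\<^sub>1 # X @ a\<^sub>1 # b\<^sub>2 # Y, twisted = T\<rparr>"
proof -
  have "euler_genus \<lparr>ends = b\<^sub>1 # a\<^sub>1 # X @ b\<^sub>2 # Y, twisted = T\<rparr>
      = euler_genus \<lparr>ends = (rev Y @ b\<^sub>2 # rev X) @ [a\<^sub>1, b\<^sub>1], twisted = T\<rparr>"
    by (subst euler_genus_rev[symmetric]) simp
  also have "\<dots> = euler_genus \<lparr>ends = a\<^sub>1 # b\<^sub>1 # rev Y @ b\<^sub>2 # rev X, twisted = T\<rparr>"
    by (subst euler_genus_rotate) simp
  also have "\<dots> = euler_genus \<lparr>ends = [b\<^sub>1] @ rev Y @ b\<^sub>2 # a\<^sub>1 # rev X, twisted = T\<rparr>"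
    using euler_genus_slide_untwisted_before[OF _ b\<^sub>2 T, of a\<^sub>1 "rev Y" "rev X"] dist by auto
  also have "\<dots> = euler_genus \<lparr>ends = rev (b\<^sub>1 # X @ a\<^sub>1 # b\<^sub>2 # Y), twisted = T\<rparr>"
    by (subst euler_genus_rotate) simp
  finally show ?thesis by (simp only: euler_genus_rev)
qed

lemma euler_genus_slide_twisted_after:
  assumes dist: "distinct (a\<^sub>1 # b\<^sub>1 # X @ b\<^sub>2 # Y)" and b\<^sub>2: "b\<^sub>2 = other_end b\<^sub>1"
    and ab: "fst a\<^sub>1 \<noteq> fst b\<^sub>1" and T: "fst b\<^sub>1 \<in> T"
    and T': "\<And>e. e \<in> T' \<longleftrightarrow> (e \<in> T \<longleftrightarrow> e \<noteq> fst a\<^sub>1)"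
  shows "euler_genus \<lparr>ends = b\<^sub>1 # a\<^sub>1 # X @ b\<^sub>2 # Y, twisted = T\<rparr>
       = euler_genus \<lparr>ends = b\<^sub>1 # X @ b\<^sub>2 # a\<^sub>1 # Y, twisted = T'\<rparr>"
proof -
  have "euler_genus \<lparr>ends = b\<^sub>1 # a\<^sub>1 # X @ b\<^sub>2 # Y, twisted = T\<rparr>
      = euler_genus \<lparr>ends = (rev Y @ b\<^sub>2 # rev X) @ [a\<^sub>1, b\<^sub>1], twisted = T\<rparr>"
    by (subst euler_genus_rev[symmetric]) simp
  also have "\<dots> = euler_genus \<lparr>ends = a\<^sub>1 # b\<^sub>1 # rev Y @ b\<^sub>2 # rev X, twisted = T\<rparr>"
    by (subst euler_genus_rotate) simp
  also have "\<dots> = euler_genus \<lparr>ends = [b\<^sub>1] @ rev Y @ a\<^sub>1 # b\<^sub>2 # rev X, twisted = T'\<rparr>"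
    using euler_genus_slide_twisted_before[OF _ b\<^sub>2 ab T T', of "rev Y" "rev X"] dist by auto
  also have "\<dots> = euler_genus \<lparr>ends = rev (b\<^sub>1 # X @ b\<^sub>2 # a\<^sub>1 # Y), twisted = T'\<rparr>"
    by (subst euler_genus_rotate) simp
  finally show ?thesis by (simp only: euler_genus_rev)
qed

section \<open>Summing over all framings\<close>

definition framing_sum :: "'e chord_end list \<Rightarrow> int poly" where
  "framing_sum l =
     (\<Sum>T\<in>Pow (fst ` set l). monom 1 (nat (euler_genus \<lparr>ends = l, twisted = T\<rparr>)))"

text \<open>
  Switching the chords of a set \<open>A\<close> is the symmetric difference with \<open>A\<close>, so as \<open>A\<close> varies, every
  framing occurs exactly once, whatever the framing of \<open>B\<close> is.
\<close>

lemma partial_petrial_poly_eq_framing_sum: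
  assumes "twisted B \<subseteq> chords B"
  shows "partial_petrial_poly B = framing_sum (ends B)"
proof -
  let ?f = "\<lambda>A. (twisted B - A) \<union> (A - twisted B)"
  have "switch_framing A B = \<lparr>ends = ends B, twisted = ?f A\<rparr>" for A
    by (simp add: switch_framing_def)
  then show ?thesis
    unfolding partial_petrial_poly_def framing_sum_def chords_def[symmetric]
    by (intro sum.reindex_bij_witness[where i = ?f and j = ?f]) (use assms in auto)
qed

lemma framing_sum_rotate: "framing_sum (xs @ ys) = framing_sum (ys @ xs)"
  unfolding framing_sum_def euler_genus_rotate[of xs ys] by (simp add: Un_commute)

text \<open>
  The set \<open>{e. e \<in> T \<longleftrightarrow> e \<noteq> a}\<close> is \<open>T\<close> with the membership of \<open>a\<close> switched. As \<open>a \<noteq> b\<close>, this is an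
  involution of the sets that contain \<open>b\<close>.
\<close>

lemma sum_Pow_toggle:
  fixes f g :: "'a set \<Rightarrow> 'b::comm_monoid_add"
  assumes "a \<in> C" and "a \<noteq> b"
  shows "(\<Sum>T\<in>Pow C. if b \<in> T then f {e. e \<in> T \<longleftrightarrow> e \<noteq> a} else g T)
       = (\<Sum>T\<in>Pow C. if b \<in> T then f T else g T)"
proof -
  let ?t = "\<lambda>T. if b \<in> T then {e. e \<in> T \<longleftrightarrow> e \<noteq> a} else T"
  show ?thesis
    by (rule sum.reindex_bij_witness[where i = ?t and j = ?t]) (use assms in \<open>auto split: if_splits\<close>)
qed

lemma framing_sum_four_term:
  fixes a\<^sub>1 b\<^sub>1 b\<^sub>2 :: "'e chord_end"
  assumes dist: "distinct (a\<^sub>1 # b\<^sub>1 # X @ b\<^sub>2 # Y)" and b\<^sub>2: "b\<^sub>2 = other_end b\<^sub>1"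
    and ab: "fst a\<^sub>1 \<noteq> fst b\<^sub>1"
  shows "framing_sum (a\<^sub>1 # b\<^sub>1 # X @ b\<^sub>2 # Y) + framing_sum (b\<^sub>1 # a\<^sub>1 # X @ b\<^sub>2 # Y)
       = framing_sum (b\<^sub>1 # X @ a\<^sub>1 # b\<^sub>2 # Y) + framing_sum (b\<^sub>1 # X @ b\<^sub>2 # a\<^sub>1 # Y)"
proof -
  define C where "C = fst ` set (a\<^sub>1 # b\<^sub>1 # X @ b\<^sub>2 # Y)"
  define m where "m l T = (monom 1 (nat (euler_genus \<lparr>ends = l, twisted = T\<rparr>)) :: int poly)"
    for l :: "'e chord_end list" and T
  have sum: "framing_sum l = (\<Sum>T\<in>Pow C. m l T)" if "set l = set (a\<^sub>1 # b\<^sub>1 # X @ b\<^sub>2 # Y)" for l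
    using that by (simp add: framing_sum_def C_def m_def)
  let ?W1 = "a\<^sub>1 # b\<^sub>1 # X @ b\<^sub>2 # Y" and ?W2 = "b\<^sub>1 # a\<^sub>1 # X @ b\<^sub>2 # Y"
  let ?W3 = "b\<^sub>1 # X @ a\<^sub>1 # b\<^sub>2 # Y" and ?W4 = "b\<^sub>1 # X @ b\<^sub>2 # a\<^sub>1 # Y"
  let ?t = "\<lambda>T. {e. e \<in> T \<longleftrightarrow> e \<noteq> fst a\<^sub>1}"
  have "m ?W1 T = (if fst b\<^sub>1 \<in> T then m ?W3 (?t T) else m ?W4 T)" for T
    using euler_genus_slide_untwisted_before[OF dist b\<^sub>2, of T]
      euler_genus_slide_twisted_before[OF dist b\<^sub>2 ab, of T "?t T"] by (simp add: m_def)
  then have 1: "framing_sum ?W1 = (\<Sum>T\<in>Pow C. if fst b\<^sub>1 \<in> T then m ?W3 T else m ?W4 T)"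
    using sum_Pow_toggle[of "fst a\<^sub>1" C "fst b\<^sub>1" "m ?W3" "m ?W4"] ab sum[of ?W1]
    by (simp add: C_def)
  have "m ?W2 T = (if fst b\<^sub>1 \<in> T then m ?W4 (?t T) else m ?W3 T)" for T
    using euler_genus_slide_untwisted_after[OF dist b\<^sub>2, of T]
      euler_genus_slide_twisted_after[OF dist b\<^sub>2 ab, of T "?t T"] by (simp add: m_def)
  then have 2: "framing_sum ?W2 = (\<Sum>T\<in>Pow C. if fst b\<^sub>1 \<in> T then m ?W4 T else m ?W3 T)"
    using sum_Pow_toggle[of "fst a\<^sub>1" C "fst b\<^sub>1" "m ?W4" "m ?W3"] ab sum[of ?W2]
    by (simp add: C_def insert_commute)
  have "framing_sum ?W1 + framing_sum ?W2 = (\<Sum>T\<in>Pow C. m ?W3 T + m ?W4 T)"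
    unfolding 1 2 sum.distrib[symmetric] by (rule sum.cong) auto
  also have "\<dots> = framing_sum ?W3 + framing_sum ?W4"
    unfolding sum.distrib by (subst (1 2) sum) auto
  finally show ?thesis .
qed

section \<open>Slides and exchanges as operations on cyclic words\<close>

lemma immediately_before_rotation:
  assumes "immediately_before B x y" and "x \<noteq> y"
  obtains us vs zs where "ends B = us @ vs" and "vs @ us = x # y # zs"
proof -
  let ?l = "ends B"
  obtain i where i: "i < length ?l" "?l ! i = x" "?l ! (Suc i mod length ?l) = y"
    using assms(1) unfolding immediately_before_def by blast
  have "length ?l > 1"
    using i assms(2) by (cases "length ?l = 1") auto
  then have "rotate i ?l ! 0 = x" "rotate i ?l ! 1 = y" "length (rotate i ?l) > 1"
    using i nth_rotate[of 0 ?l i] nth_rotate[of 1 ?l i] by fastforce+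
  then obtain zs where "rotate i ?l = x # y # zs"
    by (cases "rotate i ?l"; cases "tl (rotate i ?l)") auto
  then show ?thesis
    using that[of "take i ?l" "drop i ?l" zs] i by (simp add: rotate_drop_take)
qed

lemma concat_map_insert_id:
  "y \<notin> set l \<Longrightarrow> concat (map (\<lambda>z. if z = y then ys else [z]) l) = l"
  by (induction l) auto

text \<open>
  Moves and exchanges act on a word letter by letter, so they commute with cutting it in two and
  hence turn rotations into rotations. It therefore suffices to compute them on a word
  that starts with the two consecutive ends.
\<close>

lemma framing_sum_move_rotate:
  assumes "ends B = us @ vs" and "ends C = vs @ us"
  shows "framing_sum (ends (move_before x y B)) = framing_sum (ends (move_before x y C))"
    and "framing_sum (ends (move_after x y B)) = framing_sum (ends (move_after x y C))"
    and "framing_sum (ends (exchange_ends x y B)) = framing_sum (ends (exchange_ends x y C))"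
    and "framing_sum (ends (exchange_ends u v (move_before x y B))) =
         framing_sum (ends (exchange_ends u v (move_before x y C)))"
    and "framing_sum (ends (exchange_ends u v (move_after x y B))) =
         framing_sum (ends (exchange_ends u v (move_after x y C)))"
  using assms
  by (simp_all add: move_before_def move_after_def exchange_ends_def framing_sum_rotate)

lemma set_ends_move:
  assumes "x \<in> set (ends B)" "y \<in> set (ends B)" "x \<noteq> y"
  shows "set (ends (move_before x y B)) = set (ends B)"
    and "set (ends (move_after x y B)) = set (ends B)"
  using assms by (auto simp: move_before_def move_after_def split: if_splits)

lemma set_ends_exchange:
  assumes "x \<in> set (ends B)" "y \<in> set (ends B)"
  shows "set (ends (exchange_ends x y B)) = set (ends B)"
  using assms by (auto simp: exchange_ends_def image_iff)

lemma ends_switch_framing: "ends (switch_framing A B) = ends B"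
  by (simp add: switch_framing_def)

lemma ends_exchange_switch_framing:
  "ends (exchange_ends x y (switch_framing A B)) = ends (exchange_ends x y B)"
  by (simp add: switch_framing_def exchange_ends_def)

text \<open>
  Moving \<open>a\<^sub>1\<close> forgets its former position, so the result is the same from either of the two words
  that differ by the exchange of \<open>a\<^sub>1\<close> and \<open>b\<^sub>1\<close>.
\<close>

lemma ends_move:
  assumes dist: "distinct (a\<^sub>1 # b\<^sub>1 # X @ b\<^sub>2 # Y)"
    and "ends D = a\<^sub>1 # b\<^sub>1 # X @ b\<^sub>2 # Y \<or> ends D = b\<^sub>1 # a\<^sub>1 # X @ b\<^sub>2 # Y"
  shows "ends (move_before a\<^sub>1 b\<^sub>2 D) = b\<^sub>1 # X @ a\<^sub>1 # b\<^sub>2 # Y"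
    and "ends (move_after a\<^sub>1 b\<^sub>2 D) = b\<^sub>1 # X @ b\<^sub>2 # a\<^sub>1 # Y"
  using assms by (auto simp: move_before_def move_after_def concat_map_insert_id)

lemma ends_exchange:
  assumes dist: "distinct (a\<^sub>1 # b\<^sub>1 # X @ b\<^sub>2 # Y)"
  shows "ends D = a\<^sub>1 # b\<^sub>1 # X @ b\<^sub>2 # Y \<Longrightarrow>
      ends (exchange_ends a\<^sub>1 b\<^sub>1 D) = b\<^sub>1 # a\<^sub>1 # X @ b\<^sub>2 # Y"
    and "ends D = b\<^sub>1 # a\<^sub>1 # X @ b\<^sub>2 # Y \<Longrightarrow>
      ends (exchange_ends a\<^sub>1 b\<^sub>1 D) = a\<^sub>1 # b\<^sub>1 # X @ b\<^sub>2 # Y"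
    and "ends D = b\<^sub>1 # X @ a\<^sub>1 # b\<^sub>2 # Y \<Longrightarrow>
      ends (exchange_ends a\<^sub>1 b\<^sub>2 D) = b\<^sub>1 # X @ b\<^sub>2 # a\<^sub>1 # Y"
    and "ends D = b\<^sub>1 # X @ b\<^sub>2 # a\<^sub>1 # Y \<Longrightarrow>
      ends (exchange_ends a\<^sub>1 b\<^sub>2 D) = b\<^sub>1 # X @ a\<^sub>1 # b\<^sub>2 # Y"
  using dist by (auto simp: exchange_ends_def intro!: map_idI)

theorem theorem1p3:
  fixes B :: "'e chord_diagram" and a b :: 'e and a\<^sub>1 b\<^sub>1 b\<^sub>2 :: "'e chord_end"
  assumes "framed_chord_diagram B"
    and "a \<in> chords B" and "b \<in> chords B" and "a \<noteq> b"
    and "fst a\<^sub>1 = a" and "fst b\<^sub>1 = b" and "consecutive B a\<^sub>1 b\<^sub>1"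
    and "b\<^sub>2 = other_end b\<^sub>1"
  shows "partial_petrial_poly B
         - partial_petrial_poly (slide_end a\<^sub>1 b\<^sub>1 B)
         - partial_petrial_poly (exchange_ends a\<^sub>1 b\<^sub>2 (slide_end a\<^sub>1 b\<^sub>1 B))
         + partial_petrial_poly (exchange_ends a\<^sub>1 b\<^sub>1 B) = 0"
proof -
  have B: "distinct (ends B)" "set (ends B) = chords B \<times> UNIV" "twisted B \<subseteq> chords B"
    using assms(1) by (auto simp: framed_chord_diagram_def)
  have mem: "a\<^sub>1 \<in> set (ends B)" "b\<^sub>1 \<in> set (ends B)" "b\<^sub>2 \<in> set (ends B)"
    unfolding B(2) using assms by (auto simp: other_end_def mem_Times_iff)
  have neq: "a\<^sub>1 \<noteq> b\<^sub>1" "a\<^sub>1 \<noteq> b\<^sub>2" "b\<^sub>1 \<noteq> b\<^sub>2" "fst a\<^sub>1 \<noteq> fst b\<^sub>1"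
    using assms by (auto simp: other_end_def prod_eq_iff)
  define S where "S = slide_end a\<^sub>1 b\<^sub>1 B"
  have S_set: "set (ends S) = set (ends B)"
    using mem neq by (simp add: S_def slide_end_def ends_switch_framing set_ends_move flip: assms(8))
  have S_twisted: "twisted S \<subseteq> chords B"
    using B(3) assms(2,5)
    by (auto simp: S_def slide_end_def switch_framing_def move_before_def move_after_def)
  have S_exchange: "set (ends (exchange_ends a\<^sub>1 b\<^sub>2 S)) = set (ends B)"
    using mem S_set by (simp add: set_ends_exchange)
  have poly_eqs: "partial_petrial_poly B = framing_sum (ends B)"
    "partial_petrial_poly S = framing_sum (ends S)"
    "partial_petrial_poly (exchange_ends a\<^sub>1 b\<^sub>2 S) = framing_sum (ends (exchange_ends a\<^sub>1 b\<^sub>2 S))"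
    "partial_petrial_poly (exchange_ends a\<^sub>1 b\<^sub>1 B) = framing_sum (ends (exchange_ends a\<^sub>1 b\<^sub>1 B))"
    using B(3) S_twisted S_set S_exchange mem
    by (intro partial_petrial_poly_eq_framing_sum;
        simp add: chords_def set_ends_exchange; simp add: exchange_ends_def)+
  obtain us vs zs where rot: "ends B = us @ vs"
    and head: "vs @ us = a\<^sub>1 # b\<^sub>1 # zs \<or> vs @ us = b\<^sub>1 # a\<^sub>1 # zs"
    using assms(7) neq unfolding consecutive_def by (metis immediately_before_rotation)
  define w where "w = vs @ us"
  have "distinct w" "b\<^sub>2 \<in> set w"
    using rot B(1) mem(3) by (auto simp: w_def)
  moreover have "w = a\<^sub>1 # b\<^sub>1 # zs \<or> w = b\<^sub>1 # a\<^sub>1 # zs"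
    using head by (simp add: w_def)
  ultimately have perm: "distinct (a\<^sub>1 # b\<^sub>1 # zs)" "b\<^sub>2 \<in> set zs"
    using neq by auto
  then obtain X Y where zs: "zs = X @ b\<^sub>2 # Y" by (meson split_list)
  have dist: "distinct (a\<^sub>1 # b\<^sub>1 # X @ b\<^sub>2 # Y)" using perm zs by simp
  let ?W1 = "a\<^sub>1 # b\<^sub>1 # X @ b\<^sub>2 # Y" and ?W2 = "b\<^sub>1 # a\<^sub>1 # X @ b\<^sub>2 # Y"
  let ?W3 = "b\<^sub>1 # X @ a\<^sub>1 # b\<^sub>2 # Y" and ?W4 = "b\<^sub>1 # X @ b\<^sub>2 # a\<^sub>1 # Y"
  define D where "D = \<lparr>ends = vs @ us, twisted = twisted B\<rparr>"
  have D: "ends D = vs @ us" "ends D = ?W1 \<or> ends D = ?W2"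
    using head zs by (simp_all add: D_def)
  note rotate = framing_sum_move_rotate[OF rot D(1)]
  have before: "ends (move_before a\<^sub>1 b\<^sub>2 D) = ?W3" and after: "ends (move_after a\<^sub>1 b\<^sub>2 D) = ?W4"
    using ends_move[OF dist D(2)] .
  have fs_B: "framing_sum (ends B) = framing_sum (ends D)"
    unfolding rot D(1) by (rule framing_sum_rotate)
  have "framing_sum (ends B) + framing_sum (ends (exchange_ends a\<^sub>1 b\<^sub>1 B))
      = framing_sum ?W1 + framing_sum ?W2"
    using D(2)
  proof
    assume "ends D = ?W1"
    then show ?thesis by (simp only: fs_B rotate(3) ends_exchange(1)[OF dist])
  next
    assume "ends D = ?W2"
    then show ?thesis by (simp only: fs_B rotate(3) ends_exchange(2)[OF dist] add.commute)
  qed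
  also have "\<dots> = framing_sum ?W3 + framing_sum ?W4"
    using framing_sum_four_term[OF dist assms(8) neq(4)] .
  \<comment> \<open>Whichever branch of the slide applies, it yields one of the last two words, and the exchange
    yields the other.\<close>
  also have "\<dots> = framing_sum (ends S) + framing_sum (ends (exchange_ends a\<^sub>1 b\<^sub>2 S))"
    using rotate(1,2)[of a\<^sub>1 b\<^sub>2] rotate(4,5)[of a\<^sub>1 b\<^sub>2 a\<^sub>1 b\<^sub>2]
      ends_exchange(3)[OF dist before] ends_exchange(4)[OF dist after] before after
    unfolding S_def slide_end_def assms(8)[symmetric]
    by (simp add: ends_switch_framing ends_exchange_switch_framing add.commute)
  finally show ?thesis
    unfolding poly_eqs S_def[symmetric] by (simp add: algebra_simps)
qed

end
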